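(* The set of functions $f\in C[0,1]$ that are differentiable at Lebesgue-almost every point of $[0,1]$ is Haar-$1$ in $C[0,1]$.
   Context: $C[0,1]$ is the space of continuous real-valued functions on $[0,1]$ with the supremum norm, regarded as an abelian Polish group under addition. Differentiable at a point means having a finite derivative there. A subset $A$ of an abelian Polish group $X$ is called Haar-$1$ if there are a Borel set $B\subseteq X$ with $A\subseteq B$ and a set $C\subseteq X$ homeomorphic to the Cantor space $\{0,1\}^{\mathbb{N}}$ such that $|(C+x)\cap B|\leq 1$ for all $x\in X$. *)

theory Defs
  imports "HOL-Analysis.Analysis"
begin

section \<open>The space $C[0,1]$\<close>

typedef unit_interval = "{0..1::real}"
  by (rule exI[of _ 0]) simp

instantiation unit_interval :: metric_space
begin

definition dist_unit_interval :: "unit_interval \<Rightarrow> unit_interval \<Rightarrow> real"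
  where "dist_unit_interval s t = dist (Rep_unit_interval s) (Rep_unit_interval t)"

definition uniformity_unit_interval :: "(unit_interval \<times> unit_interval) filter"
  where "uniformity_unit_interval = (INF e\<in>{0 <..}. principal {(x, y). dist x y < e})"

definition open_unit_interval :: "unit_interval set \<Rightarrow> bool"
  where "open_unit_interval S = (\<forall>x\<in>S. \<forall>\<^sub>F (x', y) in uniformity. x' = x \<longrightarrow> y \<in> S)"

instance
proof
  fix x y z :: unit_interval
  show "dist x y = 0 \<longleftrightarrow> x = y"
    by (simp add: dist_unit_interval_def Rep_unit_interval_inject)
  show "dist x y \<le> dist x z + dist y z"
    unfolding dist_unit_interval_def by (rule dist_triangle2)
qed (rule uniformity_unit_interval_def open_unit_interval_def)+

end

class compact_metric_space = metric_space +
  assumes compact_UNIV_metric: "compact (UNIV :: 'a set)"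

instance unit_interval :: compact_metric_space
proof
  have "continuous_on {0..1} Abs_unit_interval"
    unfolding continuous_on_iff
    by (metis Abs_unit_interval_inverse dist_unit_interval_def)
  then have "compact (Abs_unit_interval ` {0..1})"
    by (rule compact_continuous_image) simp
  moreover have "Abs_unit_interval ` {0..1} = UNIV"
    using type_definition.Abs_image[OF type_definition_unit_interval] .
  ultimately show "compact (UNIV :: unit_interval set)"
    by simp
qed

lemma second_countable_if_countable_dense:
  fixes D :: "'a::metric_space set"
  assumes "countable D" and dense: "\<And>x e. e > 0 \<Longrightarrow> \<exists>d\<in>D. dist d x < e"
  shows "\<exists>B::'a set set. countable B \<and> open = generate_topology B"
proof -
  define B where "B = (\<lambda>(d, n). ball d (inverse (real (Suc n)))) ` (D \<times> UNIV)"
  have "countable B"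
    unfolding B_def using \<open>countable D\<close> by (intro countable_image countable_SIGMA) auto
  moreover have "topological_basis B"
  proof (rule topological_basisI)
    show "open U" if "U \<in> B" for U
      using that by (auto simp: B_def)
    fix U :: "'a set" and x
    assume "open U" "x \<in> U"
    then obtain e where e: "e > 0" "ball x e \<subseteq> U"
      by (meson openE)
    obtain n where n: "inverse (real (Suc n)) < e / 2"
      using reals_Archimedean[of "e / 2"] e by auto
    obtain d where d: "d \<in> D" "dist d x < inverse (real (Suc n))"
      using dense[of "inverse (real (Suc n))" x] by auto
    have "ball d (inverse (real (Suc n))) \<subseteq> ball x e"
    proof
      fix y assume "y \<in> ball d (inverse (real (Suc n)))"
      then show "y \<in> ball x e"
        using d n dist_triangle[of x y d] by (simp add: dist_commute)
    qed
    moreover have "ball d (inverse (real (Suc n))) \<in> B"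
      unfolding B_def using d by (intro image_eqI[of _ _ "(d, n)"]) auto
    ultimately show "\<exists>V\<in>B. x \<in> V \<and> V \<subseteq> U"
      using d e by (intro bexI[of _ "ball d (inverse (real (Suc n)))"]) auto
  qed
  then have "open = generate_topology B"
    by (rule topological_basis_imp_subbasis)
  ultimately show ?thesis by blast
qed

lemma bcontfun_countable_dense:
  "\<exists>F :: ('a::compact_metric_space \<Rightarrow>\<^sub>C 'b::{metric_space, second_countable_topology}) set.
     countable F \<and> (\<forall>g. \<forall>e>0. \<exists>f\<in>F. dist f g < e)"
proof -
  have "\<forall>m. \<exists>N::'a set. finite N \<and> UNIV \<subseteq> (\<Union>x\<in>N. ball x (inverse (real (Suc m))))"
    using compact_UNIV_metric unfolding compact_eq_totally_bounded
    by (metis inverse_positive_iff_positive of_nat_0_less_iff zero_less_Suc)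
  then obtain N :: "nat \<Rightarrow> 'a set" where
    N: "\<And>m. finite (N m)" "\<And>m. UNIV \<subseteq> (\<Union>x\<in>N m. ball x (inverse (real (Suc m))))"
    by metis
  obtain D :: "'b set" where
    D: "countable D" "\<And>X. open X \<Longrightarrow> X \<noteq> {} \<Longrightarrow> \<exists>d\<in>D. d \<in> X"
    using countable_dense_setE by metis
  define P where "P = (\<lambda>m n \<phi> (f :: 'a \<Rightarrow>\<^sub>C 'b).
    \<forall>x\<in>N m. \<forall>z\<in>ball x (inverse (real (Suc m))). dist (f z) (\<phi> x) < inverse (real (Suc n)))"
  define I where "I = (SIGMA m:(UNIV::nat set). (UNIV::nat set) \<times> PiE (N m) (\<lambda>_. D))"
  define F where "F = (\<lambda>(m, n, \<phi>). SOME f. P m n \<phi> f) ` I"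
  have "countable I"
    unfolding I_def using N(1) D(1) by (intro countable_SIGMA countable_PiE) auto
  then have "countable F"
    unfolding F_def by (rule countable_image)
  moreover have "\<exists>f\<in>F. dist f g < e" if "e > 0" for g e
  proof -
    obtain n where n: "inverse (real (Suc n)) < e / 4"
      using reals_Archimedean[of "e / 4"] \<open>e > 0\<close> by auto
    define r where "r = inverse (real (Suc n)) / 2"
    have "r > 0" by (simp add: r_def)
    have "uniformly_continuous_on UNIV (apply_bcontfun g)"
      by (rule compact_uniformly_continuous[OF _ compact_UNIV_metric]) simp
    then obtain d where d: "d > 0" "\<And>x z. dist z x < d \<Longrightarrow> dist (g z) (g x) < r"
      unfolding uniformly_continuous_on_def using \<open>r > 0\<close> by (metis UNIV_I)
    obtain m where m: "inverse (real (Suc m)) < d"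
      using reals_Archimedean d(1) by blast
    have "\<forall>x. \<exists>y\<in>D. dist (g x) y < r"
    proof
      fix x
      show "\<exists>y\<in>D. dist (g x) y < r"
        using D(2)[of "ball (g x) r"] \<open>r > 0\<close> by auto
    qed
    then obtain \<psi> where \<psi>: "\<And>x. \<psi> x \<in> D" "\<And>x. dist (g x) (\<psi> x) < r"
      by metis
    define \<phi> where "\<phi> = restrict \<psi> (N m)"
    have "P m n \<phi> g"
      unfolding P_def
    proof (intro ballI)
      fix x z assume x: "x \<in> N m" and z: "z \<in> ball x (inverse (real (Suc m)))"
      then have "dist (g z) (g x) < r"
        using d(2)[of z x] m by (simp add: dist_commute)
      then have "dist (g z) (\<psi> x) < 2 * r"
        using \<psi>(2)[of x] dist_triangle[of "g z" "\<psi> x" "g x"] by simp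
      then show "dist (g z) (\<phi> x) < inverse (real (Suc n))"
        using x by (simp add: \<phi>_def r_def)
    qed
    define f where "f = (SOME f. P m n \<phi> f)"
    have f: "P m n \<phi> f"
      unfolding f_def using \<open>P m n \<phi> g\<close> by (rule someI)
    have "(m, n, \<phi>) \<in> I"
      using \<psi>(1) by (auto simp: I_def \<phi>_def)
    then have "f \<in> F"
      unfolding F_def f_def by (intro image_eqI[of _ _ "(m, n, \<phi>)"]) auto
    moreover have "dist f g \<le> e / 2"
    proof (rule dist_bound)
      fix z
      obtain x where x: "x \<in> N m" "z \<in> ball x (inverse (real (Suc m)))"
        using N(2)[of m] by blast
      have "dist (f z) (\<phi> x) < inverse (real (Suc n))" "dist (g z) (\<phi> x) < inverse (real (Suc n))"
        using f \<open>P m n \<phi> g\<close> x unfolding P_def by blast+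
      then show "dist (f z) (g z) \<le> e / 2"
        using n dist_triangle2[of "f z" "g z" "\<phi> x"] by simp
    qed
    ultimately show ?thesis
      using \<open>e > 0\<close> by (intro bexI[of _ f]) auto
  qed
  ultimately show ?thesis by blast
qed

instance bcontfun :: (compact_metric_space, "{metric_space, second_countable_topology}")
  second_countable_topology
proof
  show "\<exists>B::('a \<Rightarrow>\<^sub>C 'b) set set. countable B \<and> open = generate_topology B"
    using bcontfun_countable_dense[where 'a='a and 'b='b] second_countable_if_countable_dense
    by metis
qed

instance bcontfun :: (compact_metric_space, polish_space) polish_space ..

text \<open>Continuous functions on the compact space \<^typ>\<open>unit_interval\<close> are bounded, so the following
  type consists of all continuous functions on $[0,1]$, with the supremum norm.\<close>

type_synonym C01 = "unit_interval \<Rightarrow>\<^sub>C real"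

text \<open>\<^const>\<open>Abs_unit_interval\<close> is unspecified outside $[0,1]$, hence the restriction of the
  derivative to $[0,1]$; at the endpoints it is one-sided.\<close>

definition differentiable_at :: "C01 \<Rightarrow> real \<Rightarrow> bool"
  where "differentiable_at f t \<longleftrightarrow>
    (\<exists>D. ((\<lambda>s. apply_bcontfun f (Abs_unit_interval s)) has_real_derivative D) (at t within {0..1}))"

text \<open>Every continuous function on $[0,1]$ is represented, and the norm is the
  supremum norm.\<close>

lemma C01_surj:
  assumes "continuous_on {0..1} h"
  shows "\<exists>f::C01. \<forall>t\<in>{0..1}. apply_bcontfun f (Abs_unit_interval t) = h t"
proof -
  define k where "k = (\<lambda>x. h (Rep_unit_interval x))"
  have "continuous_on UNIV Rep_unit_interval"
    unfolding continuous_on_iff by (metis dist_unit_interval_def)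
  moreover have "range Rep_unit_interval = {0..1}"
    by (rule type_definition.Rep_range[OF type_definition_unit_interval])
  ultimately have "continuous_on UNIV k"
    unfolding k_def using assms by (metis continuous_on_compose2 order_refl)
  moreover from this have "bounded (range k)"
    using compact_UNIV_metric compact_continuous_image compact_imp_bounded by blast
  ultimately have "k \<in> bcontfun"
    by (simp add: bcontfun_def)
  then obtain f :: C01 where "k = apply_bcontfun f"
    by (rule bcontfunE)
  then show ?thesis
    by (metis Abs_unit_interval_inverse k_def)
qed

lemma C01_norm: "norm f = (SUP t\<in>{0..1}. \<bar>apply_bcontfun f (Abs_unit_interval t)\<bar>)" for f :: C01
proof -
  have "norm f = (SUP x. \<bar>apply_bcontfun f x\<bar>)"
    by (simp add: norm_bcontfun_def dist_bcontfun_def)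
  also have "range (\<lambda>x. \<bar>apply_bcontfun f x\<bar>)
      = (\<lambda>x. \<bar>apply_bcontfun f x\<bar>) ` Abs_unit_interval ` {0..1}"
    by (simp only: type_definition.Abs_image[OF type_definition_unit_interval])
  finally show ?thesis
    by (simp only: image_image)
qed

section \<open>Haar-1 sets\<close>

text \<open>The space of binary sequences carries the product topology of the discrete topology on
  \<^typ>\<open>bool\<close>. Finiteness is stated because \<^const>\<open>card\<close> is 0 on infinite sets.\<close>

definition Haar_1 :: "'a::{polish_space, topological_ab_group_add} set \<Rightarrow> bool"
  where "Haar_1 A \<longleftrightarrow>
    (\<exists>B C. B \<in> sets borel \<and> A \<subseteq> B \<and> C homeomorphic (UNIV :: (nat \<Rightarrow> bool) set) \<and>
      (\<forall>x. finite ((\<lambda>c. c + x) ` C \<inter> B) \<and> card ((\<lambda>c. c + x) ` C \<inter> B) \<le> 1))"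

end

theory Submission
  imports Defs
begin

text \<open>
  A difference of two almost everywhere differentiable functions is almost everywhere
  differentiable, so a Cantor set \<open>C\<close> meets every translate of that class at most once as soon as
  differences of distinct elements of \<open>C\<close> fail to be differentiable on a set of positive measure.
  The two tasks are to find a tractable Borel superset of the class that still behaves well under
  differences, and a Cantor set whose differences are bad enough for that superset.

  \<^bold>\<open>The superset.\<close> Differentiability at \<open>t\<close> forces \<open>\<bar>h s - h t\<bar> \<le> K * \<bar>s - t\<bar>\<close> for all \<open>s\<close> in $[0,1]$,
  for some \<open>K\<close>; call \<open>t\<close> a \<open>K\<close>-Lipschitz point of \<open>h\<close>. If \<open>h\<close> is almost everywhere differentiable,
  the sets of \<open>n\<close>-Lipschitz points increase to a set of measure 1, so one of them has measure at
  least 3/4 (\<open>ae_differentiable_imp_largely_lipschitz\<close>). The functions with at least measure 3/4 of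
  \<open>K\<close>-Lipschitz points form a closed set, because a point that is \<open>K\<close>-Lipschitz for infinitely
  many terms of a uniformly convergent sequence is \<open>K\<close>-Lipschitz for the limit (\<open>closed_largely_lipschitz\<close>); the union over \<open>K = 0, 1, 2, \<dots>\<close> is therefore Borel.
  Two functions from the union have a common Lipschitz point, since 3/4 + 3/4 > 1, and so their
  difference has a Lipschitz point (\<open>largely_lipschitz_diff\<close>).

  \<^bold>\<open>The Cantor set.\<close> It thus suffices that differences of distinct elements of \<open>C\<close> have no Lipschitz
  point at all. A lacunary series $\sum_k e_k 16^{-k} \cos(256^k t)$ with $|e_k| \le 1$ has this
  property when $|e_k| = 1$ for infinitely many $k$ (\<open>lacunary_nowhere_lipschitz\<close>). Map a binary
  sequence \<open>x\<close> to the series whose coefficients list every coordinate of \<open>x\<close> infinitely often. The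
  difference of the images of two distinct sequences is then a series with coefficients in
  $\{-1,0,1\}$, infinitely many of them nonzero. The map is continuous by the Weierstrass test and
  injective, so its range is a Cantor set (\<open>lacunary_embedding\<close>).
\<close>

section \<open>Points of Lipschitz continuity\<close>

definition lipschitz_points :: "real \<Rightarrow> (real \<Rightarrow> real) \<Rightarrow> real set"
  where "lipschitz_points K h = {t \<in> {0..1}. \<forall>s\<in>{0..1}. \<bar>h s - h t\<bar> \<le> K * \<bar>s - t\<bar>}"

lemma lipschitz_points_mono: "K \<le> L \<Longrightarrow> lipschitz_points K h \<subseteq> lipschitz_points L h"
  unfolding lipschitz_points_def
  by (auto intro: order_trans[OF _ mult_right_mono[OF _ abs_ge_zero]])

lemma lipschitz_points_diff:
  "lipschitz_points K g \<inter> lipschitz_points L h \<subseteq> lipschitz_points (K + L) (\<lambda>s. g s - h s)"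
proof
  fix t assume t: "t \<in> lipschitz_points K g \<inter> lipschitz_points L h"
  have "\<bar>(g s - h s) - (g t - h t)\<bar> \<le> (K + L) * \<bar>s - t\<bar>" if "s \<in> {0..1}" for s
  proof -
    have "\<bar>g s - g t\<bar> \<le> K * \<bar>s - t\<bar>" "\<bar>h s - h t\<bar> \<le> L * \<bar>s - t\<bar>"
      using t that by (auto simp: lipschitz_points_def)
    then show ?thesis unfolding distrib_right by linarith
  qed
  then show "t \<in> lipschitz_points (K + L) (\<lambda>s. g s - h s)"
    using t by (auto simp: lipschitz_points_def)
qed

lemma closed_lipschitz_points:
  assumes "continuous_on {0..1} h"
  shows "closed (lipschitz_points K h)"
proof -
  have "closed {t \<in> {0..1}. \<bar>h s - h t\<bar> \<le> K * \<bar>s - t\<bar>}" for s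
    by (intro continuous_on_closed_Collect_le continuous_intros assms closed_atLeastAtMost)
  then have "closed ({0..1} \<inter> (\<Inter>s\<in>{0..1}. {t \<in> {0..1}. \<bar>h s - h t\<bar> \<le> K * \<bar>s - t\<bar>}))"
    by (intro closed_Int closed_INT) auto
  also have "{0..1} \<inter> (\<Inter>s\<in>{0..1}. {t \<in> {0..1}. \<bar>h s - h t\<bar> \<le> K * \<bar>s - t\<bar>}) = lipschitz_points K h"
    by (auto simp: lipschitz_points_def)
  finally show ?thesis .
qed

lemma sets_lipschitz_points:
  assumes "continuous_on {0..1} h"
  shows "lipschitz_points K h \<in> sets (lebesgue_on {0..1})"
proof -
  have "lipschitz_points K h \<in> sets lebesgue"
    using closed_lipschitz_points[OF assms] by (simp add: borel_closed)
  then show ?thesis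
    by (auto simp: sets_restrict_space_iff lipschitz_points_def)
qed

text \<open>Close to \<open>t\<close> the difference quotients are bounded by \<open>\<bar>D\<bar> + 1\<close>; at distance at least \<open>d\<close> from
  \<open>t\<close> they are bounded by \<open>2 * M / d\<close>, where \<open>M\<close> bounds \<open>\<bar>h\<bar>\<close>.\<close>

lemma differentiable_imp_lipschitz_point:
  assumes h: "continuous_on {0..1} h" and t: "t \<in> {0..1}"
    and D: "(h has_real_derivative D) (at t within {0..1})"
  shows "\<exists>n::nat. t \<in> lipschitz_points (real n) h"
proof -
  obtain d where d: "d > 0" "\<And>s. s \<in> {0..1} \<Longrightarrow> \<bar>s - t\<bar> < d \<Longrightarrow> \<bar>h s - h t - D * (s - t)\<bar> \<le> 1 * \<bar>s - t\<bar>"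
    using D[unfolded has_field_derivative_def has_derivative_within_alt]
    by (metis real_norm_def zero_less_one)
  have "bounded (h ` {0..1})"
    using h compact_continuous_image compact_imp_bounded by blast
  then obtain M where M: "\<And>s. s \<in> {0..1} \<Longrightarrow> \<bar>h s\<bar> \<le> M"
    unfolding bounded_iff by (metis imageI real_norm_def)
  have "M \<ge> 0" using M[OF t] by linarith
  obtain n :: nat where n: "real n \<ge> max (\<bar>D\<bar> + 1) (2 * M / d)"
    using real_arch_simple by blast
  have "\<bar>h s - h t\<bar> \<le> real n * \<bar>s - t\<bar>" if s: "s \<in> {0..1}" for s
  proof (cases "\<bar>s - t\<bar> < d")
    case True
    have "\<bar>h s - h t\<bar> \<le> \<bar>D * (s - t)\<bar> + \<bar>s - t\<bar>"
      using d(2)[OF s True] abs_triangle_ineq[of "h s - h t - D * (s - t)" "D * (s - t)"] by simp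
    also have "\<dots> = (\<bar>D\<bar> + 1) * \<bar>s - t\<bar>"
      by (simp only: abs_mult distrib_right mult_1_left)
    also have "\<dots> \<le> real n * \<bar>s - t\<bar>"
      using n by (intro mult_right_mono) auto
    finally show ?thesis .
  next
    case False
    have "\<bar>h s - h t\<bar> \<le> 2 * M"
      using M[OF s] M[OF t] by linarith
    also have "\<dots> = 2 * M / d * d"
      using d(1) by simp
    also have "\<dots> \<le> real n * \<bar>s - t\<bar>"
      using n d(1) False \<open>M \<ge> 0\<close> by (intro mult_mono) auto
    finally show ?thesis .
  qed
  then have "t \<in> lipschitz_points (real n) h"
    using t by (auto simp: lipschitz_points_def)
  then show ?thesis ..
qed

section \<open>Functions with many Lipschitz points\<close>

definition realfun :: "C01 \<Rightarrow> real \<Rightarrow> real"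
  where "realfun f t = apply_bcontfun f (Abs_unit_interval t)"

lemma continuous_on_realfun: "continuous_on {0..1} (realfun f)"
proof -
  have "continuous_on {0..1} Abs_unit_interval"
    unfolding continuous_on_iff
    by (metis Abs_unit_interval_inverse dist_unit_interval_def)
  then show ?thesis
    unfolding realfun_def by (rule continuous_on_compose2[OF continuous_on_apply_bcontfun]) auto
qed

lemma bounded_linear_realfun: "bounded_linear (\<lambda>f. realfun f t)"
  by (rule bounded_linear_intro[of _ 1]) (use norm_bounded[where 'b = real] in \<open>simp_all add: realfun_def\<close>)

lemma finite_measure_unit: "finite_measure (lebesgue_on {0..1::real})"
  by (rule finite_measure_lebesgue_on) simp

lemma measure_unit: "measure (lebesgue_on {0..1::real}) {0..1} = 1"
  by (simp add: measure_restrict_space)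

text \<open>Any threshold above 1/2 would make two such sets of points meet. The weak inequality makes the
  condition closed under limits.\<close>

definition largely_lipschitz :: "real \<Rightarrow> C01 set"
  where "largely_lipschitz K =
    {f. 3/4 \<le> measure (lebesgue_on {0..1}) (lipschitz_points K (realfun f))}"

text \<open>Let \<open>f n\<close> tend to \<open>l\<close> and let \<open>E n\<close> be the set of \<open>K\<close>-Lipschitz points of \<open>f n\<close>. A point that lies
  in infinitely many \<open>E n\<close> is a \<open>K\<close>-Lipschitz point of \<open>l\<close>, and by continuity from above the limit
  superior of sets of measure at least 3/4 has measure at least 3/4.\<close>

lemma closed_largely_lipschitz: "closed (largely_lipschitz K)"
  unfolding closed_sequential_limits
proof (intro allI impI)
  fix f l assume "(\<forall>n. f n \<in> largely_lipschitz K) \<and> f \<longlonglongrightarrow> l"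
  then have f: "\<And>n. f n \<in> largely_lipschitz K" and l: "f \<longlonglongrightarrow> l" by auto
  interpret finite_measure "lebesgue_on {0..1::real}" by (rule finite_measure_unit)
  let ?\<mu> = "measure (lebesgue_on {0..1::real})"
  define E where "E n = lipschitz_points K (realfun (f n))" for n
  define D where "D n = (\<Union>k\<in>{n..}. E k)" for n
  have E: "E n \<in> sets (lebesgue_on {0..1})" for n
    unfolding E_def by (rule sets_lipschitz_points) (rule continuous_on_realfun)
  have D: "D n \<in> sets (lebesgue_on {0..1})" for n
    unfolding D_def using E by (intro sets.countable_UN') auto
  have "(\<lambda>n. ?\<mu> (D n)) \<longlonglongrightarrow> ?\<mu> (\<Inter>n. D n)"
    using D by (intro finite_Lim_measure_decseq) (auto simp: decseq_def D_def intro: order_trans)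
  moreover have "3/4 \<le> ?\<mu> (D n)" for n
  proof -
    have "3/4 \<le> ?\<mu> (E n)"
      using f[of n] by (simp add: largely_lipschitz_def E_def)
    also have "\<dots> \<le> ?\<mu> (D n)"
      by (intro finite_measure_mono D) (auto simp: D_def)
    finally show ?thesis .
  qed
  ultimately have "3/4 \<le> ?\<mu> (\<Inter>n. D n)"
    by (intro LIMSEQ_le_const) auto
  also have "\<dots> \<le> ?\<mu> (lipschitz_points K (realfun l))"
  proof (intro finite_measure_mono sets_lipschitz_points continuous_on_realfun subsetI)
    fix t assume t: "t \<in> (\<Inter>n. D n)"
    then have "t \<in> D 0" by blast
    then have t01: "t \<in> {0..1}" by (auto simp: D_def E_def lipschitz_points_def)
    have "\<bar>realfun l s - realfun l t\<bar> \<le> K * \<bar>s - t\<bar>" if s: "s \<in> {0..1}" for s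
    proof (rule ccontr)
      assume neg: "\<not> ?thesis"
      have "(\<lambda>n. \<bar>realfun (f n) s - realfun (f n) t\<bar>) \<longlonglongrightarrow> \<bar>realfun l s - realfun l t\<bar>"
        by (intro tendsto_intros bounded_linear.tendsto[OF bounded_linear_realfun] l)
      then have "eventually (\<lambda>n. K * \<bar>s - t\<bar> < \<bar>realfun (f n) s - realfun (f n) t\<bar>) sequentially"
        using neg by (intro order_tendstoD(1)) auto
      then obtain n where n: "\<And>k. k \<ge> n \<Longrightarrow> K * \<bar>s - t\<bar> < \<bar>realfun (f k) s - realfun (f k) t\<bar>"
        by (auto simp: eventually_sequentially)
      obtain k where "k \<ge> n" "t \<in> E k" using t by (auto simp: D_def)
      then show False using n[of k] s by (force simp: E_def lipschitz_points_def)
    qed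
    then show "t \<in> lipschitz_points K (realfun l)"
      using t01 by (auto simp: lipschitz_points_def)
  qed
  finally show "l \<in> largely_lipschitz K"
    by (simp add: largely_lipschitz_def)
qed

lemma ae_differentiable_imp_largely_lipschitz:
  assumes "AE t in lebesgue_on {0..1}. differentiable_at f t"
  shows "\<exists>n::nat. f \<in> largely_lipschitz (real n)"
proof -
  interpret finite_measure "lebesgue_on {0..1::real}" by (rule finite_measure_unit)
  let ?\<mu> = "measure (lebesgue_on {0..1::real})"
  let ?E = "\<lambda>n::nat. lipschitz_points (real n) (realfun f)"
  have E: "?E n \<in> sets (lebesgue_on {0..1})" for n
    by (intro sets_lipschitz_points continuous_on_realfun)
  have "(\<lambda>n. ?\<mu> (?E n)) \<longlonglongrightarrow> ?\<mu> (\<Union>n. ?E n)"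
    using E by (intro finite_Lim_measure_incseq) (auto simp: incseq_def intro!: lipschitz_points_mono)
  also have "?\<mu> (\<Union>n. ?E n) = ?\<mu> {0..1}"
  proof (rule finite_measure_eq_AE)
    have "differentiable_at f t \<Longrightarrow> t \<in> (\<Union>n. ?E n) \<longleftrightarrow> t \<in> {0..1}" for t
      using differentiable_imp_lipschitz_point[OF continuous_on_realfun, of t f]
      unfolding differentiable_at_def realfun_def[abs_def] lipschitz_points_def by blast
    then show "AE t in lebesgue_on {0..1}. t \<in> (\<Union>n. ?E n) \<longleftrightarrow> t \<in> {0..1}"
      using assms by (auto elim: AE_mp)
  qed (use E in \<open>auto simp: sets_restrict_space_iff\<close>)
  finally have "eventually (\<lambda>n. 3/4 < ?\<mu> (?E n)) sequentially"
    by (intro order_tendstoD(1)) (auto simp: measure_unit)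
  then show ?thesis
    unfolding largely_lipschitz_def eventually_sequentially
    by (metis (mono_tags) le_refl less_imp_le mem_Collect_eq)
qed

text \<open>Both sets of Lipschitz points have measure at least 3/4 inside an interval of measure 1, so they
  share a point, and there the Lipschitz constants add up.\<close>

lemma largely_lipschitz_diff:
  assumes "f \<in> largely_lipschitz K" "g \<in> largely_lipschitz L"
  shows "lipschitz_points (K + L) (realfun (f - g)) \<noteq> {}"
proof -
  interpret finite_measure "lebesgue_on {0..1::real}" by (rule finite_measure_unit)
  let ?\<mu> = "measure (lebesgue_on {0..1::real})"
  let ?A = "lipschitz_points K (realfun f)" and ?B = "lipschitz_points L (realfun g)"
  have AB: "?A \<in> sets (lebesgue_on {0..1})" "?B \<in> sets (lebesgue_on {0..1})"
    by (intro sets_lipschitz_points continuous_on_realfun)+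
  have "?A \<inter> ?B \<noteq> {}"
  proof
    assume "?A \<inter> ?B = {}"
    then have "?\<mu> ?A + ?\<mu> ?B = ?\<mu> (?A \<union> ?B)"
      by (simp add: finite_measure_Union AB)
    also have "\<dots> \<le> ?\<mu> {0..1}"
      by (rule finite_measure_mono) (auto simp: lipschitz_points_def sets_restrict_space_iff)
    finally show False
      using assms by (simp add: measure_unit largely_lipschitz_def)
  qed
  moreover have "realfun (f - g) = (\<lambda>s. realfun f s - realfun g s)"
    by (auto simp: realfun_def)
  ultimately show ?thesis
    using lipschitz_points_diff[of K "realfun f" L "realfun g"] by auto
qed

section \<open>Lacunary cosine series\<close>

lemma power_256: "(256::real) ^ k = 16 ^ k * 16 ^ k"
  by (simp flip: power_mult_distrib)

lemma abs_cos_diff_le: "\<bar>cos u - cos v\<bar> \<le> \<bar>u - v\<bar>" for u v :: real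
proof -
  have "\<bar>cos u - cos v\<bar> = 2 * \<bar>sin ((u + v) / 2)\<bar> * \<bar>sin ((v - u) / 2)\<bar>"
    by (simp add: cos_diff_cos abs_mult)
  also have "\<dots> \<le> 2 * 1 * \<bar>(v - u) / 2\<bar>"
    by (intro mult_mono abs_sin_x_le_abs_x) auto
  finally show ?thesis by simp
qed

text \<open>A quarter turn and three quarter turns change the cosine by \<open>\<plusminus> sin u - cos u\<close>. One of the two
  changes is at least 1 in modulus, because \<open>\<bar>sin u\<bar> + \<bar>cos u\<bar> \<ge> 1\<close>. The sign \<open>\<sigma>\<close> prescribes the
  direction, so that the oscillation can be found on the side where the unit interval leaves room;
  6 is a crude bound for \<open>3/2 * pi\<close>.\<close>

lemma cos_oscillation:
  fixes u \<sigma> :: real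
  assumes "\<sigma> = 1 \<or> \<sigma> = -1"
  shows "\<exists>h. 0 \<le> h \<and> h \<le> 6 \<and> \<bar>cos (u + \<sigma> * h) - cos u\<bar> \<ge> 1"
proof -
  have c: "cos (u + pi/2) = - sin u" "cos (u - pi/2) = sin u"
    "cos (u + 3/2 * pi) = sin u" "cos (u - 3/2 * pi) = - sin u"
    by (simp_all only: cos_add cos_diff cos_3over2_pi sin_3over2_pi cos_pi_half sin_pi_half mult_zero_right
      mult_1_right mult_minus_right diff_0 diff_minus_eq_add add_0 add_0_right minus_minus
      add_uminus_conv_diff)
  have "1 = (sin u)\<^sup>2 + (cos u)\<^sup>2" by simp
  also have "\<dots> \<le> (\<bar>sin u\<bar> + \<bar>cos u\<bar>)\<^sup>2"
    by (simp add: power2_sum)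
  finally have "1\<^sup>2 \<le> (\<bar>sin u\<bar> + \<bar>cos u\<bar>)\<^sup>2" by simp
  then have "1 \<le> \<bar>sin u\<bar> + \<bar>cos u\<bar>"
    by (rule power2_le_imp_le) simp
  then have "\<bar>- sin u - cos u\<bar> \<ge> 1 \<or> \<bar>sin u - cos u\<bar> \<ge> 1"
    by linarith
  then have "\<bar>cos (u + \<sigma> * (pi/2)) - cos u\<bar> \<ge> 1 \<or> \<bar>cos (u + \<sigma> * (3/2 * pi)) - cos u\<bar> \<ge> 1"
    using assms c by auto
  moreover have "0 \<le> pi/2" "pi/2 \<le> 6" "0 \<le> 3/2 * pi" "3/2 * pi \<le> 6"
    using pi_less_4 pi_gt_zero by linarith+
  ultimately show ?thesis by metis
qed

definition lacunary :: "(nat \<Rightarrow> real) \<Rightarrow> real \<Rightarrow> real"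
  where "lacunary e t = (\<Sum>k. e k * cos (256 ^ k * t) / 16 ^ k)"

lemma summable_lacunary:
  assumes "\<And>k. \<bar>e k\<bar> \<le> 1"
  shows "summable (\<lambda>k. e k * cos (256 ^ k * t) / 16 ^ k :: real)"
proof (rule summable_comparison_test')
  show "summable (\<lambda>k. (1/16::real) ^ k)" by (simp add: summable_geometric)
  fix k :: nat
  have "\<bar>e k\<bar> * \<bar>cos (256 ^ k * t)\<bar> \<le> 1 * 1"
    by (intro mult_mono assms) auto
  then show "norm (e k * cos (256 ^ k * t) / 16 ^ k) \<le> (1/16) ^ k"
    by (simp add: abs_mult power_divide divide_right_mono)
qed

text \<open>At scale \<open>1 / 256 ^ n\<close> the term of index \<open>n\<close> dominates. It can be made to change by at least
  \<open>1 / 16 ^ n\<close>. The earlier terms have slopes at most \<open>16 ^ k\<close>, so together they change by at most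
  \<open>6 / 256 ^ n * 16 ^ n / 15 = 2/5 / 16 ^ n\<close>. The later terms are at most \<open>1 / 16 ^ k\<close> in modulus, so
  together they change by at most \<open>2/15 / 16 ^ n\<close>. This leaves 7/15, more than a third, of \<open>1 / 16 ^ n\<close>.
  The condition \<open>n > 0\<close> makes \<open>6 / 256 ^ n\<close> small enough to stay within the unit interval.\<close>

lemma lacunary_oscillation:
  fixes e :: "nat \<Rightarrow> real"
  assumes e: "\<And>k. \<bar>e k\<bar> \<le> 1" and en: "\<bar>e n\<bar> = 1" and "n > 0" and t: "t \<in> {0..1}"
  shows "\<exists>s\<in>{0..1}. \<bar>s - t\<bar> \<le> 6 / 256 ^ n \<and> 1 / (3 * 16 ^ n) \<le> \<bar>lacunary e s - lacunary e t\<bar>"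
proof -
  \<comment> \<open>Move towards the farther endpoint, which is at distance at least 1/2.\<close>
  define \<sigma> :: real where "\<sigma> = (if t \<le> 1/2 then 1 else -1)"
  obtain h where h: "0 \<le> h" "h \<le> 6" "\<bar>cos (256 ^ n * t + \<sigma> * h) - cos (256 ^ n * t)\<bar> \<ge> 1"
    using cos_oscillation[of \<sigma> "256 ^ n * t"] unfolding \<sigma>_def by metis
  define s where "s = t + \<sigma> * h / 256 ^ n"
  have dist: "\<bar>s - t\<bar> = h / 256 ^ n"
    using h by (simp add: s_def \<sigma>_def)
  have st: "\<bar>s - t\<bar> \<le> 6 / 256 ^ n"
    unfolding dist using h by (intro divide_right_mono) auto
  have "(256::real) \<le> 256 ^ n"
    using power_increasing[of 1 n "256::real"] \<open>n > 0\<close> by simp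
  then have "h / 256 ^ n \<le> 6 / 256"
    using h by (intro frac_le) auto
  then have "h / 256 ^ n \<le> 1 / 2"
    by linarith
  moreover have "0 \<le> h / 256 ^ n"
    using h by simp
  moreover have "s = t + (if t \<le> 1 / 2 then h / 256 ^ n else - (h / 256 ^ n))"
    by (simp add: s_def \<sigma>_def)
  ultimately have s01: "s \<in> {0..1}"
    using t by (smt (verit) atLeastAtMost_iff field_sum_of_halves)
  define a where "a k = e k * (cos (256 ^ k * s) - cos (256 ^ k * t)) / 16 ^ k" for k
  have a_eq: "a k = e k * cos (256 ^ k * s) / 16 ^ k - e k * cos (256 ^ k * t) / 16 ^ k" for k
    by (simp add: a_def algebra_simps diff_divide_distrib)
  have sa: "summable a"
    unfolding a_eq[abs_def] by (intro summable_diff summable_lacunary e)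
  have "lacunary e s - lacunary e t = suminf a"
    unfolding a_eq[abs_def] lacunary_def by (intro suminf_diff summable_lacunary e)
  also have "\<dots> = (\<Sum>k. a (k + Suc n)) + a n + (\<Sum>k<n. a k)"
    using suminf_split_initial_segment[OF sa, of "Suc n"] by simp
  finally have split: "lacunary e s - lacunary e t = (\<Sum>k. a (k + Suc n)) + a n + (\<Sum>k<n. a k)" .
  have main: "1 / 16 ^ n \<le> \<bar>a n\<bar>"
  proof -
    have "256 ^ n * s = 256 ^ n * t + \<sigma> * h"
      by (simp add: s_def field_simps)
    then show ?thesis
      using h(3) en by (simp add: a_def abs_mult divide_right_mono)
  qed
  have a_head: "\<bar>a k\<bar> \<le> 6 / 256 ^ n * 16 ^ k" for k
  proof -
    have "\<bar>a k\<bar> = \<bar>e k\<bar> * \<bar>cos (256 ^ k * s) - cos (256 ^ k * t)\<bar> / 16 ^ k"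
      by (simp add: a_def abs_mult)
    also have "\<dots> \<le> 1 * \<bar>256 ^ k * s - 256 ^ k * t\<bar> / 16 ^ k"
      by (intro divide_right_mono mult_mono e abs_cos_diff_le) auto
    also have "\<dots> = \<bar>s - t\<bar> * 16 ^ k"
    proof -
      have "\<bar>256 ^ k * s - 256 ^ k * t\<bar> = 256 ^ k * \<bar>s - t\<bar>"
        by (simp add: abs_mult flip: right_diff_distrib)
      then show ?thesis by (simp add: power_256)
    qed
    also have "\<dots> \<le> 6 / 256 ^ n * 16 ^ k"
      by (intro mult_right_mono st) auto
    finally show ?thesis .
  qed
  have head: "\<bar>\<Sum>k<n. a k\<bar> \<le> 2 / 5 / 16 ^ n"
  proof -
    have "\<bar>\<Sum>k<n. a k\<bar> \<le> (\<Sum>k<n. 6 / 256 ^ n * 16 ^ k)"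
      by (intro order_trans[OF sum_abs] sum_mono a_head)
    also have "\<dots> = 6 / 256 ^ n * ((16 ^ n - 1) / 15)"
      using geometric_sum[of "16::real" n] by (simp flip: sum_distrib_left del: times_divide_eq_left)
    also have "\<dots> \<le> 6 / 256 ^ n * (16 ^ n / 15)"
      by (intro mult_left_mono) auto
    also have "\<dots> = 2 / 5 / 16 ^ n"
      by (simp add: power_256)
    finally show ?thesis .
  qed
  have tail: "\<bar>\<Sum>k. a (k + Suc n)\<bar> \<le> 2 / 15 / 16 ^ n"
  proof -
    have b: "norm (a (k + Suc n)) \<le> 1 / 8 / 16 ^ n * (1/16) ^ k" for k
    proof -
      have "\<bar>cos (256 ^ j * s) - cos (256 ^ j * t)\<bar> \<le> 2" for j
        using abs_cos_le_one[of "256 ^ j * s"] abs_cos_le_one[of "256 ^ j * t"] by linarith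
      then have "\<bar>e j\<bar> * \<bar>cos (256 ^ j * s) - cos (256 ^ j * t)\<bar> / 16 ^ j \<le> 1 * 2 / 16 ^ j" for j
        by (intro divide_right_mono mult_mono e) auto
      then have "\<bar>a j\<bar> \<le> 2 / 16 ^ j" for j
        by (simp add: a_def abs_mult)
      from this[of "k + Suc n"] show ?thesis by (simp add: power_add power_divide mult_ac)
    qed
    have g: "(\<lambda>k. 1 / 8 / 16 ^ n * (1/16::real) ^ k) sums (1 / 8 / 16 ^ n * (1 / (1 - 1/16)))"
      by (intro sums_mult geometric_sums) simp
    have "norm (\<Sum>k. a (k + Suc n)) \<le> (\<Sum>k. 1 / 8 / 16 ^ n * (1/16::real) ^ k)"
      by (intro norm_suminf_le b sums_summable[OF g])
    then show ?thesis using sums_unique[OF g] by simp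
  qed
  have "1 / (3 * 16 ^ n) \<le> \<bar>lacunary e s - lacunary e t\<bar>"
  proof -
    define P :: real where "P = 1 / 16 ^ n"
    have "P \<le> \<bar>a n\<bar>" "\<bar>\<Sum>k<n. a k\<bar> \<le> 2 / 5 * P" "\<bar>\<Sum>k. a (k + Suc n)\<bar> \<le> 2 / 15 * P"
      using main head tail by (simp_all add: P_def)
    then have "P / 3 \<le> \<bar>lacunary e s - lacunary e t\<bar>"
      unfolding split by linarith
    then show ?thesis by (simp add: P_def)
  qed
  then show ?thesis using s01 st by blast
qed

text \<open>Each of the infinitely many indices \<open>n\<close> yields a difference quotient of modulus at least
  \<open>16 ^ n / 18\<close> at the given point.\<close>

lemma lacunary_nowhere_lipschitz:
  assumes e: "\<And>k. \<bar>e k\<bar> \<le> 1" and inf: "infinite {n. \<bar>e n\<bar> = 1}"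
  shows "lipschitz_points K (lacunary e) = {}"
proof (rule ccontr)
  assume "\<not> ?thesis"
  then obtain t where t: "t \<in> lipschitz_points K (lacunary e)" by blast
  then have t01: "t \<in> {0..1}" by (simp add: lipschitz_points_def)
  obtain m where m: "18 * \<bar>K\<bar> < 16 ^ m"
    using real_arch_pow[of 16] by auto
  obtain n where n: "n > m" "\<bar>e n\<bar> = 1"
    using inf unfolding infinite_nat_iff_unbounded by blast
  obtain s where s: "s \<in> {0..1}" "\<bar>s - t\<bar> \<le> 6 / 256 ^ n"
      "1 / (3 * 16 ^ n) \<le> \<bar>lacunary e s - lacunary e t\<bar>"
    using lacunary_oscillation[of e n t, OF e n(2) _ t01] n(1) by auto
  have "1 / (3 * 16 ^ n) \<le> K * \<bar>s - t\<bar>"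
    using s t by (force simp: lipschitz_points_def)
  also have "\<dots> \<le> \<bar>K\<bar> * (6 / 256 ^ n)"
    using s(2) by (intro mult_mono) auto
  also note power_256
  finally have "16 ^ n \<le> 18 * \<bar>K\<bar>"
    by (simp add: field_simps)
  moreover have "(16::real) ^ m \<le> 16 ^ n"
    using n(1) by (intro power_increasing) auto
  ultimately show False using m by linarith
qed

section \<open>A Cantor set with nowhere Lipschitz differences\<close>

lemma compact_UNIV_bool_sequences: "compact (UNIV :: (nat \<Rightarrow> bool) set)"
proof -
  have "compact_space (product_topology (\<lambda>_::nat. euclidean :: bool topology) UNIV)"
    unfolding compact_space_product_topology by (simp add: compact_space_def finite_imp_compact)
  then have "compact_space (euclidean :: (nat \<Rightarrow> bool) topology)"
    by (simp only: euclidean_product_topology)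
  then show ?thesis
    by (simp only: compact_space_def topspace_euclidean compactin_euclidean_iff)
qed

instance bcontfun :: (metric_space, banach) banach ..

text \<open>The terms of the series as elements of $C[0,1]$, with the norm bound that makes the series converge
  uniformly, whatever the coefficients in $[-1,1]$.\<close>

lemma cos_wave_exists:
  "\<exists>w :: nat \<Rightarrow> C01. \<forall>k. norm (w k) \<le> (1/16) ^ k \<and> (\<forall>t\<in>{0..1}. realfun (w k) t = cos (256 ^ k * t) / 16 ^ k)"
proof (rule choice, rule allI)
  fix k :: nat
  have "continuous_on {0..1} (\<lambda>t::real. cos (256 ^ k * t) / 16 ^ k)"
    by (intro continuous_intros) auto
  from C01_surj[OF this] obtain f :: C01 where
    f: "\<And>t. t \<in> {0..1} \<Longrightarrow> realfun f t = cos (256 ^ k * t) / 16 ^ k"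
    unfolding realfun_def by blast
  have "norm f \<le> (1/16) ^ k"
  proof (rule norm_bound)
    fix x
    have "apply_bcontfun f x = realfun f (Rep_unit_interval x)"
      by (simp add: realfun_def Rep_unit_interval_inverse)
    also have "\<dots> = cos (256 ^ k * Rep_unit_interval x) / 16 ^ k"
      by (rule f) (rule Rep_unit_interval)
    finally show "norm (apply_bcontfun f x) \<le> (1/16) ^ k"
      by (simp add: power_divide divide_right_mono)
  qed
  then show "\<exists>f::C01. norm f \<le> (1/16) ^ k \<and> (\<forall>t\<in>{0..1}. realfun f t = cos (256 ^ k * t) / 16 ^ k)"
    using f by blast
qed

text \<open>The coordinate that serves as the coefficient of index \<open>n\<close>; the pairing function makes every
  coordinate occur infinitely often. Two sequences that differ in a single place then still
  give coefficients that differ at infinitely many indices.\<close>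

definition coordinate_at :: "nat \<Rightarrow> nat"
  where "coordinate_at n = fst (prod_decode n)"

lemma infinite_coordinate_at: "infinite {n. coordinate_at n = i}"
proof
  assume "finite {n. coordinate_at n = i}"
  moreover have "range (\<lambda>j. prod_encode (i, j)) \<subseteq> {n. coordinate_at n = i}"
    by (auto simp: coordinate_at_def)
  moreover have "inj (\<lambda>j. prod_encode (i, j))"
    by (auto simp: inj_def)
  ultimately show False
    using finite_subset finite_imageD infinite_UNIV_nat by metis
qed

text \<open>The series with coefficients \<open>x (coordinate_at k)\<close>, read as 0 or 1. Its partial sums depend
  continuously on \<open>x\<close> because each involves finitely many coordinates only, and they converge
  uniformly in \<open>x\<close>.\<close>

lemma lacunary_embedding:
  "\<exists>F :: (nat \<Rightarrow> bool) \<Rightarrow> C01. continuous_on UNIV F \<and>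
    (\<forall>x y K. x \<noteq> y \<longrightarrow> lipschitz_points K (realfun (F x - F y)) = {})"
proof -
  obtain w :: "nat \<Rightarrow> C01" where w: "\<And>k. norm (w k) \<le> (1/16) ^ k"
      "\<And>k t. t \<in> {0..1} \<Longrightarrow> realfun (w k) t = cos (256 ^ k * t) / 16 ^ k"
    using cos_wave_exists by metis
  define d where "d x k = (of_bool (x (coordinate_at k)) :: real)" for x k
  define F where "F x = (\<Sum>k. d x k *\<^sub>R w k)" for x
  have nb: "norm (d x k *\<^sub>R w k) \<le> (1/16) ^ k" for x k
    using w(1)[of k] by (simp add: d_def)
  have sg: "summable (\<lambda>k. (1/16::real) ^ k)" by (simp add: summable_geometric)
  have "uniform_limit UNIV (\<lambda>n x. \<Sum>k<n. d x k *\<^sub>R w k) F sequentially"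
    unfolding F_def[abs_def] by (rule Weierstrass_m_test[OF nb sg])
  moreover have "continuous_on UNIV (\<lambda>x. \<Sum>k<n. d x k *\<^sub>R w k)" for n
  proof -
    have "continuous_on UNIV (\<lambda>x. d x k)" for k
      unfolding d_def
      by (rule continuous_on_compose2[of UNIV of_bool]) auto
    then show ?thesis by (intro continuous_intros)
  qed
  ultimately have "continuous_on UNIV F"
    by (intro uniform_limit_theorem[where F = sequentially]) auto
  moreover have "lipschitz_points K (realfun (F x - F y)) = {}" if "x \<noteq> y" for x y K
  proof -
    obtain i where i: "x i \<noteq> y i" using \<open>x \<noteq> y\<close> by blast
    define e where "e k = d x k - d y k" for k
    have "lipschitz_points K (lacunary e) = {}"
    proof (rule lacunary_nowhere_lipschitz)
      show "\<bar>e k\<bar> \<le> 1" for k by (simp add: e_def d_def)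
      have "{n. coordinate_at n = i} \<subseteq> {n. \<bar>e n\<bar> = 1}"
        using i by (auto simp: e_def d_def)
      then show "infinite {n. \<bar>e n\<bar> = 1}"
        using infinite_coordinate_at infinite_super by blast
    qed
    moreover have "realfun (F x - F y) t = lacunary e t" if t: "t \<in> {0..1}" for t
    proof -
      have sm: "summable (\<lambda>k. d z k *\<^sub>R w k)" for z
        by (rule summable_comparison_test'[OF sg nb])
      have "F x - F y = (\<Sum>k. d x k *\<^sub>R w k - d y k *\<^sub>R w k)"
        unfolding F_def by (intro suminf_diff sm)
      also have "\<dots> = (\<Sum>k. e k *\<^sub>R w k)"
        by (simp add: e_def scaleR_diff_left)
      finally have "realfun (F x - F y) t = (\<Sum>k. realfun (e k *\<^sub>R w k) t)"
        using summable_diff[OF sm sm, of x y]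
        by (simp add: bounded_linear.suminf[OF bounded_linear_realfun] e_def scaleR_diff_left)
      also have "\<dots> = lacunary e t"
        unfolding lacunary_def using w(2)[OF t]
        by (simp add: linear_scale[OF bounded_linear.linear[OF bounded_linear_realfun]])
      finally show ?thesis .
    qed
    ultimately show ?thesis
      by (auto simp: lipschitz_points_def)
  qed
  ultimately show ?thesis by blast
qed

theorem proposition3p3:
  shows "Haar_1 {f :: C01. AE t in lebesgue_on {0..1}. differentiable_at f t}"
proof -
  obtain F :: "(nat \<Rightarrow> bool) \<Rightarrow> C01" where F: "continuous_on UNIV F"
      "\<And>x y K. x \<noteq> y \<Longrightarrow> lipschitz_points K (realfun (F x - F y)) = {}"
    using lacunary_embedding by blast
  define B where "B = (\<Union>n::nat. largely_lipschitz (real n))"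
  have "B \<in> sets borel"
    unfolding B_def by (intro sets.countable_UN) (auto intro: borel_closed closed_largely_lipschitz)
  moreover have "{f. AE t in lebesgue_on {0..1}. differentiable_at f t} \<subseteq> B"
    using ae_differentiable_imp_largely_lipschitz by (auto simp: B_def)
  moreover have "range F homeomorphic (UNIV :: (nat \<Rightarrow> bool) set)"
  proof -
    \<comment> \<open>The zero function has Lipschitz points, so distinct sequences have distinct images.\<close>
    have "0 \<in> lipschitz_points 0 (realfun (F x - F x))" for x
      by (simp add: lipschitz_points_def realfun_def)
    then have "inj F"
      using F(2) by (metis empty_iff injI)
    then show ?thesis
      using homeomorphic_compact[OF compact_UNIV_bool_sequences F(1) refl] homeomorphic_sym by blast
  qed
  moreover have "finite ((\<lambda>c. c + g) ` range F \<inter> B) \<and> card ((\<lambda>c. c + g) ` range F \<inter> B) \<le> 1" for g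
  proof -
    let ?S = "(\<lambda>c. c + g) ` range F \<inter> B"
    have "p = q" if pq: "p \<in> ?S" "q \<in> ?S" for p q
    proof -
      obtain x y where xy: "p = F x + g" "q = F y + g" using pq by blast
      obtain m n :: nat where "p \<in> largely_lipschitz m" "q \<in> largely_lipschitz n"
        using pq by (auto simp: B_def)
      from largely_lipschitz_diff[OF this] have "x = y"
        using F(2)[of x y] xy by auto
      then show ?thesis using xy by simp
    qed
    then have "?S = {} \<or> (\<exists>p. ?S = {p})" by blast
    then show ?thesis by (elim disjE exE; simp only:) auto
  qed
  ultimately show ?thesis
    unfolding Haar_1_def by blast
qed

end
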